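(* Let $k\geq 1$ be an integer and let $x:C\to\mathbb{E}^n$ be a smooth curve in Euclidean space parametrized by arc length, whose mean curvature vector $H$ satisfies $\triangle^{k-1}H=0$. Then the curve is a straight line, i.e., it is totally geodesic in $\mathbb{E}^n$.
   Context: Here $C$ is a connected one-dimensional manifold with arc-length parameter $s$, so $\langle \frac{dx}{ds},\frac{dx}{ds}\rangle=1$. The Laplacian of $C$ is $\triangle=-\frac{d^2}{ds^2}$, applied componentwise to $\mathbb{E}^n$-valued functions, and $\triangle^0$ is the identity. For an isometric immersion $x:M\to\mathbb{E}^n$ of an $m$-dimensional manifold the mean curvature vector is $H=-\frac1m\triangle x$; thus for a curve ($m=1$) $H=-\triangle x=\frac{d^2x}{ds^2}$. That the curve is a straight line means that $x(s)=a_1s+a_0$ for constant vectors $a_0,a_1\in\mathbb{E}^n$ with $|a_1|=1$ (on the parameter domain of the curve). *)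

theory Defs
  imports "HOL-Analysis.Analysis"
begin

text \<open>
  A connected 1-manifold with arc-length parameter is represented by the domain of that parameter,
  a nonempty open interval of the real line.  A closed curve is represented by its periodic
  arc-length parametrization on the whole line.
  The operators below use two-sided derivatives of functions on the whole line, so on an open set
  they depend only on the restriction of the function to that set.
\<close>

definition ddt :: "(real \<Rightarrow> 'a::real_normed_vector) \<Rightarrow> real \<Rightarrow> 'a" where
  "ddt f = (\<lambda>s. vector_derivative f (at s))"

text \<open>Differentiability of every iterated derivative also gives their continuity, hence this is
  the class \<open>C\<^sup>\<infinity>\<close> when the set is open.\<close>

definition smooth_curve_on :: "real set \<Rightarrow> (real \<Rightarrow> 'a::real_normed_vector) \<Rightarrow> bool" where
  "smooth_curve_on I f \<longleftrightarrow> (\<forall>j. \<forall>s\<in>I. (ddt ^^ j) f differentiable (at s))"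

definition arc_length_on :: "real set \<Rightarrow> (real \<Rightarrow> 'a::real_inner) \<Rightarrow> bool" where
  "arc_length_on I x \<longleftrightarrow> (\<forall>s\<in>I. ddt x s \<bullet> ddt x s = 1)"

definition laplacian :: "(real \<Rightarrow> 'a::real_normed_vector) \<Rightarrow> real \<Rightarrow> 'a" where
  "laplacian f = (\<lambda>s. - ddt (ddt f) s)"

text \<open>The general formula \<open>H = - (1/m) \<triangle>x\<close> for \<open>m = 1\<close>.\<close>

definition mean_curvature_vector :: "(real \<Rightarrow> 'a::real_normed_vector) \<Rightarrow> real \<Rightarrow> 'a" where
  "mean_curvature_vector x = (\<lambda>s. - laplacian x s)"

definition straight_line_on :: "real set \<Rightarrow> (real \<Rightarrow> 'a::real_normed_vector) \<Rightarrow> bool" where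
  "straight_line_on I x \<longleftrightarrow> (\<exists>a0 a1. norm a1 = 1 \<and> (\<forall>s\<in>I. x s = s *\<^sub>R a1 + a0))"

text \<open>The second fundamental form evaluated on the pair \<open>(d/ds, d/ds)\<close>: the component of
  the ambient derivative of the unit tangent that is normal to the curve.  The tangent spaces are
  one-dimensional, so this value determines the form.\<close>

definition second_fundamental_form :: "(real \<Rightarrow> 'a::real_inner) \<Rightarrow> real \<Rightarrow> 'a" where
  "second_fundamental_form x =
     (\<lambda>s. ddt (ddt x) s - (ddt (ddt x) s \<bullet> ddt x s) *\<^sub>R ddt x s)"

definition totally_geodesic_on :: "real set \<Rightarrow> (real \<Rightarrow> 'a::real_inner) \<Rightarrow> bool" where
  "totally_geodesic_on I x \<longleftrightarrow> (\<forall>s\<in>I. second_fundamental_form x s = 0)"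

end

theory Submission
  imports Defs
begin

text \<open>
  Write \<open>D j\<close> for the \<open>j\<close>-th derivative of \<open>x\<close>.  The hypothesis says that \<open>D (2 * k) = 0\<close> on \<open>I\<close>,
  so \<open>x\<close> is locally a polynomial; a polynomial whose velocity has constant length is affine.  The
  last fact has a purely algebraic proof.  If \<open>D (m + 1) = 0\<close> on \<open>I\<close> with \<open>m \<ge> 2\<close>, differentiate
  \<open>\<langle>D 1, D 1\<rangle> = 1\<close> exactly \<open>2 * (m - 1)\<close> times.  In the Leibniz expansion every term
  \<open>\<langle>D (1 + i), D (1 + 2 * (m - 1) - i)\<rangle>\<close> other than the middle one contains a derivative of order
  above \<open>m\<close>, hence a positive multiple of \<open>\<langle>D m, D m\<rangle>\<close> vanishes.  Descending from \<open>2 * k\<close>, this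
  yields \<open>D 2 = 0\<close> (lemma \<open>unit_speed_second_derivative_zero\<close>).  So the second fundamental form
  vanishes, and integrating twice over the interval \<open>I\<close> gives the line.
\<close>

lemma ddt_cong_open:
  assumes "open S" and "s \<in> S" and "\<And>t. t \<in> S \<Longrightarrow> f t = g t"
  shows "ddt f s = ddt g s"
proof -
  have "eventually (\<lambda>t. f t = g t) (nhds s)"
    using assms eventually_nhds by blast
  then show ?thesis
    unfolding ddt_def by (intro vector_derivative_cong_eq) auto
qed

lemma smooth_curve_on_has_vector_derivative:
  assumes "smooth_curve_on S f" and "s \<in> S"
  shows "((ddt ^^ j) f has_vector_derivative (ddt ^^ Suc j) f s) (at s)"
  using assms by (auto simp: smooth_curve_on_def ddt_def vector_derivative_works)

text \<open>The identity is claimed on \<open>S\<close> only: where a function is not differentiable, \<open>ddt\<close> has an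
  unspecified value and need not commute with negation.\<close>

lemma iterated_laplacian_mean_curvature:
  assumes "smooth_curve_on S f" and "open S" and "s \<in> S"
  shows "(laplacian ^^ j) (mean_curvature_vector f) s = (- 1) ^ j *\<^sub>R (ddt ^^ (2 * j + 2)) f s"
  using \<open>s \<in> S\<close>
proof (induction j arbitrary: s)
  case 0
  then show ?case
    by (simp add: mean_curvature_vector_def laplacian_def numeral_2_eq_2)
next
  case (Suc j)
  define h where "h = (laplacian ^^ j) (mean_curvature_vector f)"
  define c :: real where "c = (- 1) ^ j"
  have scaled: "ddt (\<lambda>t. c *\<^sub>R (ddt ^^ i) f t) t = c *\<^sub>R (ddt ^^ Suc i) f t"
    if "t \<in> S" for i t
  proof -
    have "((\<lambda>t. c *\<^sub>R (ddt ^^ i) f t) has_vector_derivative c *\<^sub>R (ddt ^^ Suc i) f t) (at t)"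
      by (intro bounded_linear.has_vector_derivative[OF bounded_linear_scaleR_right]
          smooth_curve_on_has_vector_derivative[OF assms(1) that])
    then show ?thesis
      unfolding ddt_def[of "\<lambda>t. c *\<^sub>R (ddt ^^ i) f t"] by (rule vector_derivative_at)
  qed
  have "ddt h t = c *\<^sub>R (ddt ^^ Suc (2 * j + 2)) f t" if "t \<in> S" for t
    using ddt_cong_open[OF \<open>open S\<close> that, of h "\<lambda>t. c *\<^sub>R (ddt ^^ (2 * j + 2)) f t"]
      scaled[OF that] Suc.IH by (simp only: h_def c_def)
  then have "ddt (ddt h) s = c *\<^sub>R (ddt ^^ Suc (Suc (2 * j + 2))) f s"
    using ddt_cong_open[OF \<open>open S\<close> Suc.prems, of "ddt h"] scaled[OF Suc.prems] by metis
  moreover have "(laplacian ^^ Suc j) (mean_curvature_vector f) s = - ddt (ddt h) s"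
    by (simp add: h_def laplacian_def)
  moreover have "Suc (Suc (2 * j + 2)) = 2 * Suc j + 2"
    by simp
  ultimately show ?case
    by (simp only: c_def power_Suc scaleR_minus_left mult_minus1)
qed

text \<open>The Leibniz sum of order \<open>N\<close> for the \<open>N\<close>-th derivative of \<open>\<langle>F 0, F 0\<rangle>\<close>, where \<open>F (Suc i)\<close> is
  the derivative of \<open>F i\<close>, differentiates to the Leibniz sum of order \<open>Suc N\<close>.\<close>

lemma leibniz_inner_step:
  fixes F :: "nat \<Rightarrow> real \<Rightarrow> 'a::real_inner"
  assumes "\<And>i. (F i has_vector_derivative F (Suc i) s) (at s)"
  shows "((\<lambda>t. \<Sum>i\<le>N. real (N choose i) * (F i t \<bullet> F (N - i) t)) has_vector_derivative
           (\<Sum>i\<le>Suc N. real (Suc N choose i) * (F i s \<bullet> F (Suc N - i) s))) (at s)"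
proof -
  define a where "a i = F i s \<bullet> F (Suc N - i) s" for i
  have "(\<Sum>i\<le>Suc N. real (Suc N choose i) * a i)
        = a 0 + (\<Sum>i\<le>N. real (N choose Suc i) * a (Suc i)) + (\<Sum>i\<le>N. real (N choose i) * a (Suc i))"
    by (simp add: sum.atMost_Suc_shift sum.distrib distrib_right del: sum.atMost_Suc)
  also have "a 0 + (\<Sum>i\<le>N. real (N choose Suc i) * a (Suc i))
        = (\<Sum>i\<le>Suc N. real (N choose i) * a i)"
    by (simp add: sum.atMost_Suc_shift del: sum.atMost_Suc)
  finally have pascal: "(\<Sum>i\<le>Suc N. real (Suc N choose i) * a i)
        = (\<Sum>i\<le>N. real (N choose i) * (a i + a (Suc i)))"
    by (simp add: sum.distrib distrib_left)
  have "((\<lambda>t. \<Sum>i\<le>N. real (N choose i) * (F i t \<bullet> F (N - i) t)) has_vector_derivative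
          (\<Sum>i\<le>N. real (N choose i) * (F i s \<bullet> F (Suc (N - i)) s + F (Suc i) s \<bullet> F (N - i) s))) (at s)"
    by (intro has_vector_derivative_sum has_vector_derivative_mult_right
        bounded_bilinear.has_vector_derivative[OF bounded_bilinear_inner] assms)
  also have "(\<Sum>i\<le>N. real (N choose i) * (F i s \<bullet> F (Suc (N - i)) s + F (Suc i) s \<bullet> F (N - i) s))
        = (\<Sum>i\<le>N. real (N choose i) * (a i + a (Suc i)))"
    by (intro sum.cong) (auto simp: a_def Suc_diff_le)
  finally show ?thesis
    using pascal by (simp only: a_def)
qed

lemma leibniz_inner_constant:
  fixes F :: "nat \<Rightarrow> real \<Rightarrow> 'a::real_inner"
  assumes deriv: "\<And>i s. s \<in> S \<Longrightarrow> (F i has_vector_derivative F (Suc i) s) (at s)"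
    and "open S" and const: "\<And>s. s \<in> S \<Longrightarrow> F 0 s \<bullet> F 0 s = c" and "s \<in> S"
  shows "(\<Sum>i\<le>Suc N. real (Suc N choose i) * (F i s \<bullet> F (Suc N - i) s)) = 0"
proof -
  \<comment> \<open>Each Leibniz sum is the derivative of one that is constant on \<open>S\<close>.\<close>
  have locally_constant: "(\<Sum>i\<le>Suc N. real (Suc N choose i) * (F i s \<bullet> F (Suc N - i) s)) = 0"
    if "\<And>t. t \<in> S \<Longrightarrow> (\<Sum>i\<le>N. real (N choose i) * (F i t \<bullet> F (N - i) t)) = d" and "s \<in> S" for N d s
  proof -
    have "((\<lambda>t. d) has_vector_derivative
            (\<Sum>i\<le>Suc N. real (Suc N choose i) * (F i s \<bullet> F (Suc N - i) s))) (at s)"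
    proof (rule has_vector_derivative_transform_within_open[OF _ \<open>open S\<close> \<open>s \<in> S\<close> that(1)])
      show "((\<lambda>t. \<Sum>i\<le>N. real (N choose i) * (F i t \<bullet> F (N - i) t)) has_vector_derivative
              (\<Sum>i\<le>Suc N. real (Suc N choose i) * (F i s \<bullet> F (Suc N - i) s))) (at s)"
        using leibniz_inner_step[of F s N] deriv \<open>s \<in> S\<close> by blast
    qed
    then show ?thesis
      using vector_derivative_unique_at has_vector_derivative_const by blast
  qed
  show ?thesis
    using \<open>s \<in> S\<close>
  proof (induction N arbitrary: s)
    case 0
    show ?case
      by (rule locally_constant[where d = c, OF _ \<open>s \<in> S\<close>]) (simp add: const)
  next
    case (Suc N)
    show ?case
      by (rule locally_constant[where d = 0, OF Suc.IH Suc.prems])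
  qed
qed

text \<open>One step of the descent, at a single point \<open>s\<close>: when all derivatives of order at least \<open>n + 2\<close>
  vanish there, the Leibniz sum of order \<open>2 * n\<close> for the squared speed reduces to its middle term.\<close>

lemma unit_speed_derivative_descent:
  fixes f :: "real \<Rightarrow> 'a::real_inner"
  assumes "smooth_curve_on S f" and "open S" and "arc_length_on S f" and "s \<in> S"
    and "n \<ge> 1" and zero: "\<And>j. j \<ge> n + 2 \<Longrightarrow> (ddt ^^ j) f s = 0"
  shows "(ddt ^^ (n + 1)) f s = 0"
proof -
  define F where "F i = (ddt ^^ (i + 1)) f" for i
  obtain N where N: "2 * n = Suc N"
    using \<open>n \<ge> 1\<close> by (cases "2 * n") auto
  have "(\<Sum>i\<le>2 * n. real (2 * n choose i) * (F i s \<bullet> F (2 * n - i) s)) = 0"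
    unfolding N
  proof (rule leibniz_inner_constant[OF _ \<open>open S\<close> _ \<open>s \<in> S\<close>])
    show "(F i has_vector_derivative F (Suc i) t) (at t)" if "t \<in> S" for i t
      using smooth_curve_on_has_vector_derivative[OF assms(1) that, of "i + 1"] by (simp add: F_def)
    show "F 0 t \<bullet> F 0 t = 1" if "t \<in> S" for t
      using assms(3) that by (simp add: F_def arc_length_on_def)
  qed
  moreover have "(\<Sum>i\<le>2 * n. real (2 * n choose i) * (F i s \<bullet> F (2 * n - i) s))
      = (\<Sum>i\<in>{n}. real (2 * n choose i) * (F i s \<bullet> F (2 * n - i) s))"
  proof (rule sum.mono_neutral_right)
    show "\<forall>i\<in>{..2 * n} - {n}. real (2 * n choose i) * (F i s \<bullet> F (2 * n - i) s) = 0"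
    proof
      fix i assume "i \<in> {..2 * n} - {n}"
      then consider "i + 1 \<ge> n + 2" | "2 * n - i + 1 \<ge> n + 2"
        by fastforce
      then have "F i s = 0 \<or> F (2 * n - i) s = 0"
        unfolding F_def using zero by cases blast+
      then show "real (2 * n choose i) * (F i s \<bullet> F (2 * n - i) s) = 0"
        by auto
    qed
  qed auto
  ultimately have "real (2 * n choose n) * (F n s \<bullet> F n s) = 0"
    by simp
  then have "F n s = 0"
    by simp
  then show ?thesis
    by (simp add: F_def)
qed

lemma unit_speed_second_derivative_zero:
  fixes f :: "real \<Rightarrow> 'a::real_inner"
  assumes "smooth_curve_on S f" and "open S" and "arc_length_on S f"
    and "\<And>s. s \<in> S \<Longrightarrow> (ddt ^^ (m + 2)) f s = 0" and "s \<in> S"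
  shows "(ddt ^^ 2) f s = 0"
proof -
  have higher: "(ddt ^^ (m + 2 + j)) f t = 0" if "t \<in> S" for j t
    using that
  proof (induction j arbitrary: t)
    case 0
    then show ?case using assms(4) by simp
  next
    case (Suc j)
    have "ddt ((ddt ^^ (m + 2 + j)) f) t = ddt (\<lambda>_. 0) t"
      using Suc by (intro ddt_cong_open[OF \<open>open S\<close>]) auto
    also have "\<dots> = 0"
      by (simp add: ddt_def)
    finally show ?case
      by simp
  qed
  have "(ddt ^^ (2 + j)) f s = 0" for j
  proof -
    have "\<forall>j. (ddt ^^ (p + 2 + j)) f s = 0" if "p \<le> m" for p
      using that
    proof (induction p rule: inc_induct)
      case base
      then show ?case using higher \<open>s \<in> S\<close> by simp
    next
      case (step p)
      have above: "(ddt ^^ i) f s = 0" if "i \<ge> Suc p + 2" for i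
        using step.IH that by (metis le_add_diff_inverse)
      have "(ddt ^^ (Suc p + 1)) f s = 0"
        by (rule unit_speed_derivative_descent[OF assms(1-3,5)]) (use above in auto)
      then have "(ddt ^^ i) f s = 0" if "i \<ge> p + 2" for i
        using above[of i] that by (cases "i = p + 2") auto
      then show ?case
        using le_add1 by blast
    qed
    from this[of 0] show ?thesis
      by simp
  qed
  from this[of 0] show ?thesis
    by simp
qed

lemma second_derivative_zero_imp_straight_line_on:
  fixes f :: "real \<Rightarrow> 'a::real_inner"
  assumes "smooth_curve_on S f" and "arc_length_on S f" and "S \<noteq> {}" and "connected S"
    and "\<And>s. s \<in> S \<Longrightarrow> (ddt ^^ 2) f s = 0"
  shows "straight_line_on S f"
proof -
  have "convex S"
    using \<open>connected S\<close> is_interval_connected_1 is_interval_convex_1 by blast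
  have deriv: "((ddt ^^ j) f has_vector_derivative (ddt ^^ Suc j) f s) (at s within S)"
    if "s \<in> S" for j s
    by (rule has_vector_derivative_at_within[OF
          smooth_curve_on_has_vector_derivative[OF assms(1) that]])
  have "(ddt f has_vector_derivative 0) (at s within S)" if "s \<in> S" for s
    using deriv[OF that, of 1] assms(5)[OF that] by (simp add: numeral_2_eq_2)
  then obtain a1 where a1: "\<And>s. s \<in> S \<Longrightarrow> ddt f s = a1"
    using has_vector_derivative_zero_constant[OF \<open>convex S\<close>] by blast
  have "((\<lambda>t. f t - t *\<^sub>R a1) has_vector_derivative 0) (at s within S)" if "s \<in> S" for s
  proof -
    have "((\<lambda>t. f t - t *\<^sub>R a1) has_vector_derivative ddt f s - 1 *\<^sub>R a1) (at s within S)"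
    proof (rule has_vector_derivative_diff)
      show "(f has_vector_derivative ddt f s) (at s within S)"
        using deriv[OF that, of 0] by simp
      show "((\<lambda>t. t *\<^sub>R a1) has_vector_derivative 1 *\<^sub>R a1) (at s within S)"
        by (rule bounded_linear.has_vector_derivative[OF bounded_linear_scaleR_left
              has_vector_derivative_id])
    qed
    then show ?thesis
      using a1[OF that] by simp
  qed
  then obtain a0 where a0: "\<And>s. s \<in> S \<Longrightarrow> f s - s *\<^sub>R a1 = a0"
    using has_vector_derivative_zero_constant[OF \<open>convex S\<close>] by blast
  have "norm a1 = 1"
    using \<open>S \<noteq> {}\<close> assms(2) a1 by (auto simp: arc_length_on_def norm_eq_sqrt_inner)
  moreover have "f s = s *\<^sub>R a1 + a0" if "s \<in> S" for s
    using a0[OF that] by (simp add: algebra_simps)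
  ultimately show ?thesis
    unfolding straight_line_on_def by blast
qed

theorem theorem5p5:
  fixes x :: "real \<Rightarrow> real ^ 'n" and I :: "real set" and k :: nat
  assumes "k \<ge> 1"
    and "I \<noteq> {}" and "open I" and "connected I"
    and "smooth_curve_on I x"
    and "arc_length_on I x"
    and "\<forall>s\<in>I. (laplacian ^^ (k - 1)) (mean_curvature_vector x) s = 0"
  shows "straight_line_on I x \<and> totally_geodesic_on I x"
proof -
  have "(ddt ^^ (2 * (k - 1) + 2)) x s = 0" if "s \<in> I" for s
    using iterated_laplacian_mean_curvature[OF assms(5,3) that, of "k - 1"] assms(7) that by simp
  then have D2: "(ddt ^^ 2) x s = 0" if "s \<in> I" for s
    using unit_speed_second_derivative_zero[OF assms(5,3,6)] that by blast
  then have "totally_geodesic_on I x"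
    by (simp add: totally_geodesic_on_def second_fundamental_form_def numeral_2_eq_2)
  with D2 show ?thesis
    using second_derivative_zero_imp_straight_line_on[OF assms(5,6,2,4)] by blast
qed

end
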